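(* Let $T>0$, $x_0\in\mathbb{R}$, and let $\sigma:\mathbb{R}\to\mathbb{R}$ be a measurable function such that $Z(\sigma):=\{x\in\mathbb{R}:\sigma(x)=0\}$ is nonempty and countable. Let $\{X^{(n)}\}_{n\in\mathbb{N}}$ be the Euler--Maruyama scheme with initial values $x_n\in\mathbb{R}\setminus Z(\sigma)$, $x_n\to x_0$. Then for every $n\in\mathbb{N}$, $X^{(n)}$ satisfies the non-sticky condition $$\mathbb{E}\left[\int_0^T\mathbf{1}_{Z(\sigma)}(X^{(n)}_s)\,\mathrm{d}s\right]=0.$$
   Context: $W=(W_t)_{t\in[0,T]}$ is a one-dimensional standard Brownian motion on a probability space $(\Omega,\mathcal{F},\mathbb{P})$ with a filtration $(\mathcal{F}_t)$ satisfying the usual conditions. Euler--Maruyama scheme: fix a sequence $\{x_n\}_{n\in\mathbb{N}}\subset\mathbb{R}\setminus Z(\sigma)$ with $\lim_{n\to\infty}x_n=x_0$. For $n\in\mathbb{N}$ put $t_k^{(n)}=kT/n$ and $\eta_n(s)=t_k^{(n)}$ if $s\in[t_k^{(n)},t_{k+1}^{(n)})$. Then $X^{(n)}=(X^{(n)}_t)_{t\in[0,T]}$ is defined by $X^{(n)}_t=x_n+\int_0^t\sigma(X^{(n)}_{\eta_n(s)})\,\mathrm{d}W_s$. *)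

theory Defs
  imports "HOL-Probability.Probability"
begin

text \<open>
  Stochastic processes are curried functions \<open>X t \<omega>\<close>; only times \<open>t \<in> {0..T}\<close> matter.
  A filtration assigns to each such time a measure, of which only the \<open>\<sigma>\<close>-algebra is used.
\<close>

definition usual_filtration :: "'a measure \<Rightarrow> (real \<Rightarrow> 'a measure) \<Rightarrow> real \<Rightarrow> bool" where
  "usual_filtration M F T \<longleftrightarrow>
     (\<forall>t\<in>{0..T}. subalgebra M (F t)) \<and>
     (\<forall>s\<in>{0..T}. \<forall>t\<in>{s..T}. sets (F s) \<subseteq> sets (F t)) \<and>
     (\<forall>t\<in>{0..<T}. sets (F t) = (\<Inter>s\<in>{t<..T}. sets (F s))) \<and>
     (\<forall>N\<in>null_sets M. \<forall>A. A \<subseteq> N \<longrightarrow> A \<in> sets (F 0))"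

definition adapted_process :: "(real \<Rightarrow> 'a measure) \<Rightarrow> real \<Rightarrow> (real \<Rightarrow> 'a \<Rightarrow> real) \<Rightarrow> bool" where
  "adapted_process F T X \<longleftrightarrow> (\<forall>t\<in>{0..T}. X t \<in> borel_measurable (F t))"

definition progressively_measurable ::
    "(real \<Rightarrow> 'a measure) \<Rightarrow> real \<Rightarrow> (real \<Rightarrow> 'a \<Rightarrow> real) \<Rightarrow> bool" where
  "progressively_measurable F T X \<longleftrightarrow>
     (\<forall>t\<in>{0..T}. (\<lambda>(s, \<omega>). X s \<omega>) \<in> borel_measurable (restrict_space borel {0..t} \<Otimes>\<^sub>M F t))"

definition continuous_paths :: "'a measure \<Rightarrow> real \<Rightarrow> (real \<Rightarrow> 'a \<Rightarrow> real) \<Rightarrow> bool" where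
  "continuous_paths M T X \<longleftrightarrow> (AE \<omega> in M. continuous_on {0..T} (\<lambda>t. X t \<omega>))"

definition brownian_motion ::
    "'a measure \<Rightarrow> (real \<Rightarrow> 'a measure) \<Rightarrow> real \<Rightarrow> (real \<Rightarrow> 'a \<Rightarrow> real) \<Rightarrow> bool" where
  "brownian_motion M F T W \<longleftrightarrow>
     adapted_process F T W \<and>
     continuous_paths M T W \<and>
     (AE \<omega> in M. W 0 \<omega> = 0) \<and>
     (\<forall>s\<in>{0..T}. \<forall>t\<in>{s<..T}.
        distributed M lborel (\<lambda>\<omega>. W t \<omega> - W s \<omega>) (normal_density 0 (sqrt (t - s))) \<and>
        prob_space.indep_set M (sets (F s))
          (sets (vimage_algebra (space M) (\<lambda>\<omega>. W t \<omega> - W s \<omega>) borel)))"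

text \<open>
  \<open>H\<close> is the bounded simple process \<open>\<Sum>k<m. \<xi>\<^sub>k 1\<^bsub>(p\<^sub>k, p\<^sub>k\<^sub>+\<^sub>1]\<^esub>\<close> and \<open>I\<close> is its stochastic integral
  with respect to \<open>W\<close>.
\<close>

definition simple_ito_integral ::
    "(real \<Rightarrow> 'a measure) \<Rightarrow> real \<Rightarrow> (real \<Rightarrow> 'a \<Rightarrow> real) \<Rightarrow>
     (real \<Rightarrow> 'a \<Rightarrow> real) \<Rightarrow> (real \<Rightarrow> 'a \<Rightarrow> real) \<Rightarrow> bool" where
  "simple_ito_integral F T W H I \<longleftrightarrow>
     (\<exists>(m::nat) (p :: nat \<Rightarrow> real) (\<xi> :: nat \<Rightarrow> 'a \<Rightarrow> real).
        p 0 = 0 \<and> p m = T \<and> (\<forall>k<m. p k < p (Suc k)) \<and>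
        (\<forall>k<m. \<xi> k \<in> borel_measurable (F (p k))) \<and>
        (\<forall>k<m. \<exists>C. \<forall>\<omega>\<in>space (F (p k)). \<bar>\<xi> k \<omega>\<bar> \<le> C) \<and>
        H = (\<lambda>s \<omega>. \<Sum>k<m. \<xi> k \<omega> * indicator {p k<..p (Suc k)} s) \<and>
        I = (\<lambda>t \<omega>. \<Sum>k<m. \<xi> k \<omega> * (W (min (p (Suc k)) t) \<omega> - W (min (p k) t) \<omega>)))"

text \<open>
  \<open>I\<close> is (a version with almost surely continuous paths of) the Ito integral process
  \<open>\<integral>\<^sub>0\<^sup>t H\<^sub>s dW\<^sub>s\<close>, \<open>t \<in> {0..T}\<close>: the limit in probability of integrals of bounded simple processes
  \<open>Hs j\<close> for which \<open>\<integral>\<^sub>0\<^sup>T (Hs j - H)\<^sup>2 ds\<close> tends to 0 in probability. Such an approximation exists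
  iff \<open>\<integral>\<^sub>0\<^sup>T H\<^sup>2 ds\<close> is almost surely finite, and it determines \<open>I\<close> up to indistinguishability.
  Progressive measurability of \<open>H\<close> makes the events below measurable.
\<close>

definition ito_integral ::
    "'a measure \<Rightarrow> (real \<Rightarrow> 'a measure) \<Rightarrow> real \<Rightarrow> (real \<Rightarrow> 'a \<Rightarrow> real) \<Rightarrow>
     (real \<Rightarrow> 'a \<Rightarrow> real) \<Rightarrow> (real \<Rightarrow> 'a \<Rightarrow> real) \<Rightarrow> bool" where
  "ito_integral M F T W H I \<longleftrightarrow>
     progressively_measurable F T H \<and> adapted_process F T I \<and> continuous_paths M T I \<and>
     (\<exists>(Hs :: nat \<Rightarrow> real \<Rightarrow> 'a \<Rightarrow> real) (Is :: nat \<Rightarrow> real \<Rightarrow> 'a \<Rightarrow> real).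
        (\<forall>j. simple_ito_integral F T W (Hs j) (Is j)) \<and>
        (\<forall>\<epsilon>>0. (\<lambda>j. measure M {\<omega> \<in> space M.
            (\<integral>\<^sup>+s\<in>{0..T}. ennreal ((Hs j s \<omega> - H s \<omega>)\<^sup>2) \<partial>lborel) > ennreal \<epsilon>}) \<longlonglongrightarrow> 0) \<and>
        (\<forall>t\<in>{0..T}. \<forall>\<epsilon>>0. (\<lambda>j. measure M {\<omega> \<in> space M. \<bar>Is j t \<omega> - I t \<omega>\<bar> > \<epsilon>}) \<longlonglongrightarrow> 0))"

definition grid :: "real \<Rightarrow> nat \<Rightarrow> nat \<Rightarrow> real" where
  "grid T n k = real k * T / real n"

definition eta :: "real \<Rightarrow> nat \<Rightarrow> real \<Rightarrow> real" where
  "eta T n s = grid T n (nat \<lfloor>s * real n / T\<rfloor>)"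

lemma eta_eq_grid:
  assumes "T > 0" "n \<ge> 1" and s: "s \<in> {grid T n k..<grid T n (Suc k)}"
  shows "eta T n s = grid T n k"
proof -
  have "real k \<le> s * real n / T" "s * real n / T < real k + 1"
    using assms by (simp_all add: grid_def field_simps)
  then have "\<lfloor>s * real n / T\<rfloor> = int k"
    by linarith
  then show ?thesis
    by (simp add: eta_def)
qed

text \<open>\<open>X\<^sub>t = x + \<integral>\<^sub>0\<^sup>t \<sigma>(X\<^bsub>\<eta>\<^sub>n(s)\<^esub>) dW\<^sub>s\<close> for \<open>t \<in> {0..T}\<close>\<close>

definition euler_maruyama ::
    "'a measure \<Rightarrow> (real \<Rightarrow> 'a measure) \<Rightarrow> real \<Rightarrow> (real \<Rightarrow> 'a \<Rightarrow> real) \<Rightarrow>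
     (real \<Rightarrow> real) \<Rightarrow> nat \<Rightarrow> real \<Rightarrow> (real \<Rightarrow> 'a \<Rightarrow> real) \<Rightarrow> bool" where
  "euler_maruyama M F T W \<sigma> n x X \<longleftrightarrow>
     ito_integral M F T W (\<lambda>s \<omega>. \<sigma> (X (eta T n s) \<omega>)) (\<lambda>t \<omega>. X t \<omega> - x)"

definition zero_set :: "(real \<Rightarrow> real) \<Rightarrow> real set" where
  "zero_set \<sigma> = {x. \<sigma> x = 0}"

definition non_sticky ::
    "'a measure \<Rightarrow> real \<Rightarrow> (real \<Rightarrow> real) \<Rightarrow> (real \<Rightarrow> 'a \<Rightarrow> real) \<Rightarrow> bool" where
  "non_sticky M T \<sigma> X \<longleftrightarrow>
     (\<integral>\<^sup>+\<omega>. (\<integral>\<^sup>+s\<in>{0..T}. indicator (zero_set \<sigma>) (X s \<omega>) \<partial>lborel) \<partial>M) = 0"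

end

theory Submission
  imports Defs
begin

text \<open>
  On a grid interval \<open>(t\<^sub>k, t\<^sub>k\<^sub>+\<^sub>1]\<close> the scheme is \<open>X\<^sub>t = Y + \<sigma>(Y) (W\<^sub>t - W\<^bsub>t\<^sub>k\<^esub>)\<close> with \<open>Y = X\<^bsub>t\<^sub>k\<^esub>\<close>.
  If \<open>Y\<close> avoids the zeros of \<open>\<sigma>\<close> almost surely, then given \<open>Y\<close> this is a nondegenerate Gaussian
  variable, which almost surely avoids the countable set of zeros; induction over the grid carries
  this to all times, and Fubini's theorem gives the claim. The formula for \<open>X\<^sub>t\<close> is extracted from the
  approximation of the Ito integral by simple processes: a simple integral with energy
  \<open>\<integral>K\<^sup>2 ds\<close> satisfies \<open>P(\<bar>\<integral>K dW\<bar> > \<epsilon>) \<le> P(\<integral>K\<^sup>2 ds > \<delta>) + \<delta>/\<epsilon>\<^sup>2\<close>.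
\<close>

section \<open>Brownian increments: measurability, independence of the past, moments\<close>

locale brownian_setting = prob_space M
  for M :: "'a measure" and F :: "real \<Rightarrow> 'a measure" and W :: "real \<Rightarrow> 'a \<Rightarrow> real" and T :: real +
  assumes T_pos: "T > 0"
    and filtration: "usual_filtration M F T"
    and brownian: "brownian_motion M F T W"
begin

lemma subalgebra_F: "t \<in> {0..T} \<Longrightarrow> subalgebra M (F t)"
  using filtration by (auto simp: usual_filtration_def)

lemma space_F: "t \<in> {0..T} \<Longrightarrow> space (F t) = space M"
  using subalgebra_F by (auto simp: subalgebra_def)

lemma measurable_F_imp_M:
  "f \<in> measurable (F t) N \<Longrightarrow> t \<in> {0..T} \<Longrightarrow> f \<in> measurable M N"
  using measurable_from_subalg[OF subalgebra_F] by blast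

lemma measurable_F_mono:
  assumes "f \<in> measurable (F s) N" "0 \<le> s" "s \<le> t" "t \<le> T"
  shows "f \<in> measurable (F t) N"
proof (rule measurable_from_subalg)
  show "subalgebra (F t) (F s)"
    using filtration assms space_F[of s] space_F[of t]
    by (auto simp: usual_filtration_def subalgebra_def)
qed (fact assms)

lemma W_measurable_F: "t \<in> {0..T} \<Longrightarrow> W t \<in> borel_measurable (F t)"
  using brownian by (auto simp: brownian_motion_def adapted_process_def)

lemma increment_distributed:
  assumes "0 \<le> s" "s < t" "t \<le> T"
  shows "distributed M lborel (\<lambda>\<omega>. W t \<omega> - W s \<omega>) (normal_density 0 (sqrt (t - s)))"
  using brownian assms by (auto simp: brownian_motion_def)

lemma increment_measurable:
  assumes "0 \<le> s" "s \<le> t" "t \<le> T"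
  shows "(\<lambda>\<omega>. W t \<omega> - W s \<omega>) \<in> borel_measurable (F t)"
  using assms W_measurable_F[of t] measurable_F_mono[OF W_measurable_F, of s t]
  by (intro borel_measurable_diff) auto

text \<open>Independence passes to smaller \<sigma>-algebras: the one generated by \<open>Y\<close>
  lies in \<open>F s\<close>, and the one generated by the increment is the
  \<open>vimage_algebra\<close> from the definition of Brownian motion. The target space
  \<open>N\<close> is left arbitrary so that \<open>Y\<close> can be any information available at
  time \<open>s\<close>.\<close>

lemma increment_indep:
  assumes "0 \<le> s" "s < t" "t \<le> T" and Y: "Y \<in> measurable (F s) N"
  shows "indep_var N Y borel (\<lambda>\<omega>. W t \<omega> - W s \<omega>)"
  unfolding indep_var_eq
proof (intro conjI)
  let ?D = "\<lambda>\<omega>. W t \<omega> - W s \<omega>"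
  show "random_variable N Y"
    using measurable_F_imp_M[OF Y] assms by auto
  show "random_variable borel ?D"
    using measurable_F_imp_M[OF increment_measurable] assms by auto
  have ind: "indep_set (sets (F s)) (sets (vimage_algebra (space M) ?D borel))"
    using brownian assms by (auto simp: brownian_motion_def)
  have "{Y -` A \<inter> space M |A. A \<in> sets N} \<subseteq> sets (F s)"
    using measurable_sets[OF Y] space_F[of s] assms by auto
  then have "sigma_sets (space M) {Y -` A \<inter> space M |A. A \<in> sets N} \<subseteq> sets (F s)"
    using sets.sigma_sets_subset[of _ "F s"] space_F[of s] assms by auto
  moreover have "sigma_sets (space M) {?D -` A \<inter> space M |A. A \<in> sets borel}
      = sets (vimage_algebra (space M) ?D borel)"
    by (simp add: sets_vimage_algebra)
  ultimately show "indep_set (sigma_sets (space M) {Y -` A \<inter> space M |A. A \<in> sets N})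
     (sigma_sets (space M) {?D -` A \<inter> space M |A. A \<in> sets borel})"
    using ind unfolding indep_sets2_eq by blast
qed

lemma increment_moments:
  assumes "0 \<le> s" "s < t" "t \<le> T"
  shows "integrable M (\<lambda>\<omega>. W t \<omega> - W s \<omega>)" "expectation (\<lambda>\<omega>. W t \<omega> - W s \<omega>) = 0"
    and "integrable M (\<lambda>\<omega>. (W t \<omega> - W s \<omega>)\<^sup>2)" "expectation (\<lambda>\<omega>. (W t \<omega> - W s \<omega>)\<^sup>2) = t - s"
proof -
  note D = increment_distributed[OF assms]
  have pos: "0 < sqrt (t - s)" using assms by simp
  show "integrable M (\<lambda>\<omega>. W t \<omega> - W s \<omega>)"
    by (rule distributed_integrable_var[OF D]) (auto intro: integrable_normal_moment_nz_1 pos)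
  show e: "expectation (\<lambda>\<omega>. W t \<omega> - W s \<omega>) = 0"
    using normal_distributed_expectation[OF pos D] .
  show "integrable M (\<lambda>\<omega>. (W t \<omega> - W s \<omega>)\<^sup>2)"
    using distributed_integrable[OF D, of "\<lambda>x. x\<^sup>2"] integrable_normal_moment[OF pos, of 0 2] by simp
  show "expectation (\<lambda>\<omega>. (W t \<omega> - W s \<omega>)\<^sup>2) = t - s"
    using normal_distributed_variance[OF pos D] e assms by simp
qed

section \<open>One step of the Ito isometry, and the tail bound for simple integrals\<close>

text \<open>Expand the square. The cross term has mean zero because \<open>S * g\<close> is known at
  time \<open>s\<close> and the independent increment is centred; the last term factors because the
  squares of \<open>g\<close> and of the increment are independent. Boundedness of \<open>g\<close>
  supplies the integrability that both product formulas require.\<close>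

lemma ito_isometry_step:
  assumes st: "0 \<le> s" "s < t" "t \<le> T"
    and S: "S \<in> borel_measurable (F s)" "integrable M (\<lambda>\<omega>. (S \<omega>)\<^sup>2)"
    and g: "g \<in> borel_measurable (F s)" "\<And>\<omega>. \<bar>g \<omega>\<bar> \<le> C"
  shows "integrable M (\<lambda>\<omega>. (S \<omega> + g \<omega> * (W t \<omega> - W s \<omega>))\<^sup>2)"
    and "expectation (\<lambda>\<omega>. (S \<omega> + g \<omega> * (W t \<omega> - W s \<omega>))\<^sup>2) =
      expectation (\<lambda>\<omega>. (S \<omega>)\<^sup>2) + expectation (\<lambda>\<omega>. (g \<omega>)\<^sup>2 * (t - s))"
proof -
  let ?D = "\<lambda>\<omega>. W t \<omega> - W s \<omega>"
  have SM[measurable]: "S \<in> borel_measurable M" and gM[measurable]: "g \<in> borel_measurable M"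
    using measurable_F_imp_M[OF S(1)] measurable_F_imp_M[OF g(1)] st by auto
  have i1: "indep_var borel (\<lambda>\<omega>. S \<omega> * g \<omega>) borel ?D"
    by (rule increment_indep[OF st]) (use S(1) g(1) in measurable)
  have "indep_var borel ((\<lambda>x. x\<^sup>2) \<circ> g) borel ((\<lambda>x. x\<^sup>2) \<circ> ?D)"
    by (rule indep_var_compose[OF increment_indep[OF st g(1)]]) auto
  then have i2: "indep_var borel (\<lambda>\<omega>. (g \<omega>)\<^sup>2) borel (\<lambda>\<omega>. (?D \<omega>)\<^sup>2)"
    by (simp add: o_def)
  have C: "0 \<le> C" using g(2)[of undefined] by linarith
  \<comment> \<open>Only the square of \<open>S\<close> is known to be integrable, so
    \<open>S * g\<close> is dominated through it; the inequality for
    \<open>\<bar>S \<omega>\<bar>\<close> comes from expanding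
    \<open>(\<bar>S \<omega>\<bar> - 1)\<^sup>2 \<ge> 0\<close>.\<close>
  have bnd: "\<bar>S \<omega> * g \<omega>\<bar> \<le> C * (1 + (S \<omega>)\<^sup>2)" for \<omega>
  proof -
    have "\<bar>S \<omega>\<bar> \<le> 1 + (S \<omega>)\<^sup>2"
      using sum_squares_ge_zero[of "\<bar>S \<omega>\<bar> - 1" 0] zero_le_power2[of "\<bar>S \<omega>\<bar> - 1"]
        zero_le_power2[of "S \<omega>"] by (simp add: power2_diff)
    then show ?thesis
      using mult_mono[of "\<bar>g \<omega>\<bar>" C "\<bar>S \<omega>\<bar>" "1 + (S \<omega>)\<^sup>2"] g(2)[of \<omega>] C by (simp add: abs_mult ac_simps)
  qed
  have iSg: "integrable M (\<lambda>\<omega>. S \<omega> * g \<omega>)"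
    by (rule Bochner_Integration.integrable_bound[of M "\<lambda>\<omega>. C * (1 + (S \<omega>)\<^sup>2)"])
      (use bnd S(2) C in \<open>auto intro!: AE_I2 simp: order_trans[OF bnd]\<close>)
  have g2: "(g \<omega>)\<^sup>2 \<le> C\<^sup>2" for \<omega>
    using g(2)[of \<omega>] C by (metis abs_of_nonneg abs_le_square_iff)
  have ig2: "integrable M (\<lambda>\<omega>. (g \<omega>)\<^sup>2)"
    by (rule integrable_const_bound[of _ "C\<^sup>2"]) (use g2 in auto)
  note m = increment_moments[OF st]
  have a: "integrable M (\<lambda>\<omega>. S \<omega> * g \<omega> * ?D \<omega>)" "expectation (\<lambda>\<omega>. S \<omega> * g \<omega> * ?D \<omega>) = 0"
    using indep_var_integrable[OF i1 iSg m(1)] indep_var_lebesgue_integral[OF i1 iSg m(1)] m(2) by auto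
  have b: "integrable M (\<lambda>\<omega>. (g \<omega>)\<^sup>2 * (?D \<omega>)\<^sup>2)"
    "expectation (\<lambda>\<omega>. (g \<omega>)\<^sup>2 * (?D \<omega>)\<^sup>2) = expectation (\<lambda>\<omega>. (g \<omega>)\<^sup>2) * (t - s)"
    using indep_var_integrable[OF i2 ig2 m(3)] indep_var_lebesgue_integral[OF i2 ig2 m(3)] m(4) by auto
  have eq: "(\<lambda>\<omega>. (S \<omega> + g \<omega> * ?D \<omega>)\<^sup>2) =
      (\<lambda>\<omega>. (S \<omega>)\<^sup>2 + (2 * (S \<omega> * g \<omega> * ?D \<omega>) + (g \<omega>)\<^sup>2 * (?D \<omega>)\<^sup>2))"
    by (simp add: fun_eq_iff power2_eq_square algebra_simps)
  show "integrable M (\<lambda>\<omega>. (S \<omega> + g \<omega> * ?D \<omega>)\<^sup>2)"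
    unfolding eq using S(2) a(1) b(1) by auto
  show "expectation (\<lambda>\<omega>. (S \<omega> + g \<omega> * ?D \<omega>)\<^sup>2) =
      expectation (\<lambda>\<omega>. (S \<omega>)\<^sup>2) + expectation (\<lambda>\<omega>. (g \<omega>)\<^sup>2 * (t - s))"
    unfolding eq using S(2) a b by simp
qed

text \<open>
  The integrand is switched off as soon as its accumulated energy exceeds \<open>\<delta>\<close>; Chebyshev's
  inequality applies to the stopped sum, which agrees with the original one unless the total
  energy exceeds \<open>\<delta>\<close>.
\<close>

lemma simple_integral_tail_bound:
  fixes q :: "nat \<Rightarrow> real" and g :: "nat \<Rightarrow> 'a \<Rightarrow> real"
  assumes q: "\<And>k. k < m \<Longrightarrow> q k \<le> q (Suc k)" "0 \<le> q 0" "q m \<le> T"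
    and g: "\<And>k. k < m \<Longrightarrow> g k \<in> borel_measurable (F (q k))"
    and pos: "\<delta> > 0" "\<epsilon> > 0"
  shows "prob {\<omega>\<in>space M. \<bar>\<Sum>k<m. g k \<omega> * (W (q (Suc k)) \<omega> - W (q k) \<omega>)\<bar> > \<epsilon>} \<le>
    prob {\<omega>\<in>space M. (\<Sum>k<m. (g k \<omega>)\<^sup>2 * (q (Suc k) - q k)) > \<delta>} + \<delta> / \<epsilon>\<^sup>2"
proof -
  define V where "V k \<omega> = (\<Sum>l<k. (g l \<omega>)\<^sup>2 * (q (Suc l) - q l))" for k \<omega>
  \<comment> \<open>The test uses \<open>V (Suc k)\<close>, which already counts the energy of
    interval \<open>k\<close>. That energy is known at time \<open>q k\<close> because
    \<open>g k\<close> is, so \<open>h k\<close> does not anticipate, and switching off before the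
    interval is used prevents any overshoot above \<delta>.\<close>
  define h where "h k \<omega> = (if V (Suc k) \<omega> \<le> \<delta> then g k \<omega> else 0)" for k \<omega>
  define S where "S k \<omega> = (\<Sum>l<k. h l \<omega> * (W (q (Suc l)) \<omega> - W (q l) \<omega>))" for k \<omega>
  define E where "E k \<omega> = (\<Sum>l<k. (h l \<omega>)\<^sup>2 * (q (Suc l) - q l))" for k \<omega>
  have q_mono: "q i \<le> q j" if "i \<le> j" "j \<le> m" for i j
    using that by (induction j rule: dec_induct) (use q(1) in \<open>auto intro: order_trans\<close>)
  have q_range: "0 \<le> q k" "q k \<le> T" if "k \<le> m" for k
    using q_mono[of 0 k] q_mono[of k m] that q by auto
  have g_meas: "g l \<in> borel_measurable (F (q k))" if "l \<le> k" "k \<le> m" "l < m" for l k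
    using measurable_F_mono[OF g[of l], of "q k"] q_mono[of l k] q_range that by auto
  have V_meas: "V (Suc k) \<in> borel_measurable (F (q k))" if "k < m" for k
    unfolding V_def using that by (intro borel_measurable_sum borel_measurable_times borel_measurable_power)
      (auto intro!: g_meas)
  have h_meas: "h k \<in> borel_measurable (F (q k))" if "k < m" for k
  proof -
    have [measurable]: "V (Suc k) \<in> borel_measurable (F (q k))" "g k \<in> borel_measurable (F (q k))"
      using V_meas g that by auto
    show ?thesis unfolding h_def by measurable
  qed
  have S_meas: "S k \<in> borel_measurable (F (q k))" if "k \<le> m" for k
    unfolding S_def
  proof (intro borel_measurable_sum borel_measurable_times)
    fix l assume l: "l \<in> {..<k}"
    show "h l \<in> borel_measurable (F (q k))"
      using measurable_F_mono[OF h_meas[of l], of "q k"] q_mono[of l k] q_range that l by auto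
    show "(\<lambda>\<omega>. W (q (Suc l)) \<omega> - W (q l) \<omega>) \<in> borel_measurable (F (q k))"
      using measurable_F_mono[OF increment_measurable, of "q l" "q (Suc l)" "q k"]
        q_mono[of "Suc l" k] q_range q(1) that l by auto
  qed
  have V_mono: "V i \<omega> \<le> V j \<omega>" if "i \<le> j" "j \<le> m" for i j \<omega>
    unfolding V_def using that q(1) by (intro sum_mono2) auto
  have V_nonneg: "0 \<le> V j \<omega>" if "j \<le> m" for j \<omega>
    using V_mono[of 0 j \<omega>] that by (simp add: V_def)
  \<comment> \<open>The second conjunct strengthens the induction: as long as \<open>V\<close> is at
    most \<delta>, \<open>E\<close> coincides with it, and once \<open>V\<close> has passed \<delta>
    it stays above by monotonicity, so \<open>E\<close> is frozen.\<close>
  have E_le: "E k \<omega> \<le> \<delta> \<and> (V k \<omega> \<le> \<delta> \<longrightarrow> E k \<omega> = V k \<omega>)" if "k \<le> m" for k \<omega>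
    using that
  proof (induction k)
    case 0 then show ?case using pos by (simp add: E_def V_def)
  next
    case (Suc k)
    have "V k \<omega> \<le> V (Suc k) \<omega>" using Suc.prems by (intro V_mono) auto
    moreover have "E (Suc k) \<omega> = E k \<omega> + (h k \<omega>)\<^sup>2 * (q (Suc k) - q k)"
      "V (Suc k) \<omega> = V k \<omega> + (g k \<omega>)\<^sup>2 * (q (Suc k) - q k)"
      by (auto simp: E_def V_def)
    ultimately show ?case using Suc by (auto simp: h_def)
  qed
  \<comment> \<open>The isometry step needs a bounded coefficient, which \<open>g k\<close> need not
    be. A single interval contributes energy at most \<delta> to the stopped sum, and dividing by
    its length bounds \<open>h k\<close>; this is why the interval must be nondegenerate.\<close>
  have h_bound: "\<exists>C. \<forall>\<omega>. \<bar>h k \<omega>\<bar> \<le> C" if "k < m" "q k < q (Suc k)" for k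
  proof (intro exI allI)
    fix \<omega>
    have "(h k \<omega>)\<^sup>2 * (q (Suc k) - q k) \<le> \<delta>"
    proof (cases "V (Suc k) \<omega> \<le> \<delta>")
      case True
      then show ?thesis using V_nonneg[of k \<omega>] that by (auto simp: h_def V_def)
    qed (use pos in \<open>auto simp: h_def\<close>)
    then have "(h k \<omega>)\<^sup>2 \<le> \<delta> / (q (Suc k) - q k)"
      using that by (simp add: pos_le_divide_eq)
    then show "\<bar>h k \<omega>\<bar> \<le> sqrt (\<delta> / (q (Suc k) - q k))"
      by (rule real_le_rsqrt[of "\<bar>h k \<omega>\<bar>", simplified power2_abs])
  qed
  \<comment> \<open>The isometry step is iterated over the nondegenerate intervals; on a degenerate
    one neither \<open>S\<close> nor \<open>E\<close> changes.\<close>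
  have iso: "integrable M (\<lambda>\<omega>. (S k \<omega>)\<^sup>2) \<and> integrable M (E k) \<and>
      expectation (\<lambda>\<omega>. (S k \<omega>)\<^sup>2) = expectation (E k)" if "k \<le> m" for k
    using that
  proof (induction k)
    case 0 then show ?case by (simp add: S_def E_def)
  next
    case (Suc k)
    have IH: "integrable M (\<lambda>\<omega>. (S k \<omega>)\<^sup>2)" "integrable M (E k)"
      "expectation (\<lambda>\<omega>. (S k \<omega>)\<^sup>2) = expectation (E k)"
      using Suc by auto
    have Ssuc: "S (Suc k) = (\<lambda>\<omega>. S k \<omega> + h k \<omega> * (W (q (Suc k)) \<omega> - W (q k) \<omega>))"
      and Esuc: "E (Suc k) = (\<lambda>\<omega>. E k \<omega> + (h k \<omega>)\<^sup>2 * (q (Suc k) - q k))"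
      by (auto simp: S_def E_def)
    show ?case
    proof (cases "q k < q (Suc k)")
      case True
      obtain C where C: "\<And>\<omega>. \<bar>h k \<omega>\<bar> \<le> C"
        using h_bound[of k] True Suc.prems by auto
      have st: "0 \<le> q k" "q (Suc k) \<le> T" using q_range Suc.prems by auto
      have hM[measurable]: "h k \<in> borel_measurable M"
        using measurable_F_imp_M[OF h_meas] q_range[of k] Suc.prems by auto
      note step = ito_isometry_step[OF st(1) True st(2) S_meas[of k] IH(1) h_meas[of k] C]
      have "(h k \<omega>)\<^sup>2 \<le> C\<^sup>2" for \<omega>
        using C[of \<omega>] by (metis abs_ge_self abs_le_square_iff order_trans)
      then have "integrable M (\<lambda>\<omega>. (h k \<omega>)\<^sup>2)"
        by (intro integrable_const_bound[of _ "C\<^sup>2"]) auto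
      then have i: "integrable M (\<lambda>\<omega>. (h k \<omega>)\<^sup>2 * (q (Suc k) - q k))"
        by auto
      show ?thesis
        unfolding Ssuc Esuc using step Suc.prems IH i by auto
    next
      case False
      then have "q k = q (Suc k)" using q(1)[of k] Suc.prems by auto
      then show ?thesis unfolding Ssuc Esuc using IH by simp
    qed
  qed
  have SM[measurable]: "S m \<in> borel_measurable M"
    using measurable_F_imp_M[OF S_meas] q_range[of m] by auto
  have [measurable]: "V m \<in> borel_measurable M"
    unfolding V_def
    by (intro borel_measurable_sum borel_measurable_times borel_measurable_power)
      (use measurable_F_imp_M[OF g] q_range in auto)
  have "expectation (E m) \<le> expectation (\<lambda>_. \<delta>)"
    using iso[of m] E_le[of m] by (intro integral_mono) auto
  then have ES: "expectation (\<lambda>\<omega>. (S m \<omega>)\<^sup>2) \<le> \<delta>"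
    using iso[of m] by (simp add: prob_space)
  have "prob {\<omega>\<in>space M. (S m \<omega>)\<^sup>2 \<ge> \<epsilon>\<^sup>2} \<le> expectation (\<lambda>\<omega>. (S m \<omega>)\<^sup>2) / \<epsilon>\<^sup>2"
    using iso[of m] pos by (intro integral_Markov_inequality_measure[of _ _ "{}"]) auto
  also have "\<dots> \<le> \<delta> / \<epsilon>\<^sup>2"
    using ES pos by (intro divide_right_mono) auto
  finally have cheb: "prob {\<omega>\<in>space M. (S m \<omega>)\<^sup>2 \<ge> \<epsilon>\<^sup>2} \<le> \<delta> / \<epsilon>\<^sup>2" .
  have S_eq: "S m \<omega> = (\<Sum>k<m. g k \<omega> * (W (q (Suc k)) \<omega> - W (q k) \<omega>))" if "V m \<omega> \<le> \<delta>" for \<omega>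
    unfolding S_def
  proof (intro sum.cong refl)
    fix l assume "l \<in> {..<m}"
    then have "V (Suc l) \<omega> \<le> \<delta>" using V_mono[of "Suc l" m \<omega>] that by auto
    then show "h l \<omega> * (W (q (Suc l)) \<omega> - W (q l) \<omega>) = g l \<omega> * (W (q (Suc l)) \<omega> - W (q l) \<omega>)"
      by (simp add: h_def)
  qed
  have "prob {\<omega>\<in>space M. \<bar>\<Sum>k<m. g k \<omega> * (W (q (Suc k)) \<omega> - W (q k) \<omega>)\<bar> > \<epsilon>} \<le>
    prob ({\<omega>\<in>space M. V m \<omega> > \<delta>} \<union> {\<omega>\<in>space M. (S m \<omega>)\<^sup>2 \<ge> \<epsilon>\<^sup>2})"
  proof (rule finite_measure_mono)
    show "{\<omega>\<in>space M. \<bar>\<Sum>k<m. g k \<omega> * (W (q (Suc k)) \<omega> - W (q k) \<omega>)\<bar> > \<epsilon>} \<subseteq>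
      {\<omega>\<in>space M. V m \<omega> > \<delta>} \<union> {\<omega>\<in>space M. (S m \<omega>)\<^sup>2 \<ge> \<epsilon>\<^sup>2}"
    proof clarify
      fix \<omega> assume "\<omega> \<in> space M" and w: "\<bar>\<Sum>k<m. g k \<omega> * (W (q (Suc k)) \<omega> - W (q k) \<omega>)\<bar> > \<epsilon>"
        and "\<not> \<epsilon>\<^sup>2 \<le> (S m \<omega>)\<^sup>2"
      then have "\<bar>S m \<omega>\<bar> < \<epsilon>"
        using pos by (metis abs_le_square_iff abs_of_pos linorder_not_le)
      then show "V m \<omega> > \<delta>" using S_eq[of \<omega>] w by force
    qed
  qed measurable
  also have "\<dots> \<le> prob {\<omega>\<in>space M. V m \<omega> > \<delta>} + prob {\<omega>\<in>space M. (S m \<omega>)\<^sup>2 \<ge> \<epsilon>\<^sup>2}"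
    by (rule measure_Un_le) measurable
  finally show ?thesis
    using cheb by (simp add: V_def)
qed

section \<open>Simple processes as approximants: measurability and energy distance\<close>

lemma simple_ito_nodes:
  fixes p :: "nat \<Rightarrow> real"
  assumes "p 0 = 0" "p m = T" "\<forall>k<m. p k < p (Suc k)"
  shows "i \<le> j \<Longrightarrow> j \<le> m \<Longrightarrow> p i \<le> p j" and "k \<le> m \<Longrightarrow> p k \<in> {0..T}"
proof -
  show mono: "p i \<le> p j" if "i \<le> j" "j \<le> m" for i j
    using that
  proof (induction j rule: dec_induct)
    case (step n)
    then show ?case using assms(3)[rule_format, of n] by simp
  qed simp
  show "p k \<in> {0..T}" if "k \<le> m"
    using mono[of 0 k] mono[of k m] that assms by auto
qed

lemma simple_ito_measurable:
  assumes "simple_ito_integral F T W H I" "t \<in> {0..T}"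
  shows "I t \<in> borel_measurable M"
proof -
  obtain m :: nat and p \<xi> where p: "p 0 = 0" "p m = T" "\<forall>k<m. p k < p (Suc k)"
    and \<xi>: "\<forall>k<m. \<xi> k \<in> borel_measurable (F (p k))"
    and I: "I = (\<lambda>t \<omega>. \<Sum>k<m. \<xi> k \<omega> * (W (min (p (Suc k)) t) \<omega> - W (min (p k) t) \<omega>))"
    using assms(1) by (auto simp: simple_ito_integral_def)
  note r = simple_ito_nodes(2)[OF p]
  have W: "W (min (p k) t) \<in> borel_measurable M" if "k \<le> m" for k
    using measurable_F_imp_M[OF W_measurable_F, of "min (p k) t"] r[OF that] assms(2) by auto
  show ?thesis
    unfolding I
    by (intro borel_measurable_sum borel_measurable_times borel_measurable_diff)
      (use \<xi> r in \<open>auto intro!: W intro: measurable_F_imp_M\<close>)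
qed

lemma simple_ito_at_0:
  assumes "simple_ito_integral F T W H I"
  shows "I 0 \<omega> = 0"
proof -
  obtain m :: nat and p \<xi> where p: "p 0 = 0" "p m = T" "\<forall>k<m. p k < p (Suc k)"
    and I: "I = (\<lambda>t \<omega>. \<Sum>k<m. \<xi> k \<omega> * (W (min (p (Suc k)) t) \<omega> - W (min (p k) t) \<omega>))"
    using assms(1) by (auto simp: simple_ito_integral_def)
  have "min (p k) 0 = 0" if "k \<le> m" for k
    using simple_ito_nodes(2)[OF p that] by auto
  then show ?thesis unfolding I by (intro sum.neutral) auto
qed

text \<open>Up to time \<open>T\<close> both processes are jointly measurable in time and
  \<open>F T\<close>: \<open>H\<close> by progressive measurability, \<open>K\<close> because every
  \<open>\<xi> k\<close> is \<open>F T\<close>-measurable and multiplies a function of time.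
  Integrating out time preserves measurability. This makes the energy events measurable, as
  monotonicity of the probability requires of the larger event.\<close>

lemma energy_distance_measurable:
  assumes "simple_ito_integral F T W K I" and H: "progressively_measurable F T H"
  shows "(\<lambda>\<omega>. \<integral>\<^sup>+s\<in>{0..T}. ennreal ((K s \<omega> - H s \<omega>)\<^sup>2) \<partial>lborel) \<in> borel_measurable M"
proof -
  obtain m :: nat and p \<xi> where p: "p 0 = 0" "p m = T" "\<forall>k<m. p k < p (Suc k)"
    and \<xi>: "\<forall>k<m. \<xi> k \<in> borel_measurable (F (p k))"
    and K: "K = (\<lambda>s \<omega>. \<Sum>k<m. \<xi> k \<omega> * indicator {p k<..p (Suc k)} s)"
    using assms(1) by (auto simp: simple_ito_integral_def)
  note r = simple_ito_nodes(2)[OF p]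
  let ?R = "restrict_space borel {0..T} :: real measure"
  let ?L = "restrict_space lborel {0..T} :: real measure"
  have \<xi>T: "\<xi> k \<in> borel_measurable (F T)" if "k < m" for k
    using measurable_F_mono[of "\<xi> k" "p k" borel T] \<xi> r[of k] that by auto
  have [measurable]: "fst \<in> borel_measurable (?R \<Otimes>\<^sub>M F T)"
    by (rule measurable_compose[OF measurable_fst measurable_restrict_space1]) simp
  have K': "(\<lambda>x. K (fst x) (snd x)) \<in> borel_measurable (?R \<Otimes>\<^sub>M F T)"
    unfolding K
    by (intro borel_measurable_sum borel_measurable_times)
      (auto intro!: measurable_compose[OF measurable_snd \<xi>T])
  have H': "(\<lambda>x. H (fst x) (snd x)) \<in> borel_measurable (?R \<Otimes>\<^sub>M F T)"
    using H T_pos by (auto simp: progressively_measurable_def case_prod_beta')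
  have "(\<lambda>x. ennreal ((K (fst x) (snd x) - H (fst x) (snd x))\<^sup>2)) \<in> borel_measurable (?R \<Otimes>\<^sub>M F T)"
    using K' H' by measurable
  \<comment> \<open>\<open>?R\<close> and \<open>?L\<close> have the same measurable sets, but only
    \<open>?L\<close> carries Lebesgue measure. The factors are then swapped so that time, the
    variable to be integrated out, comes second.\<close>
  then have "(\<lambda>x. ennreal ((K (fst x) (snd x) - H (fst x) (snd x))\<^sup>2)) \<in> borel_measurable (?L \<Otimes>\<^sub>M F T)"
    by (subst measurable_cong_sets[OF sets_pair_measure_cong refl, of ?L ?R])
      (auto intro!: sets_restrict_space_cong)
  then have *: "case_prod (\<lambda>\<omega> s. ennreal ((K s \<omega> - H s \<omega>)\<^sup>2)) \<in> borel_measurable (F T \<Otimes>\<^sub>M ?L)"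
    by (subst (asm) measurable_pair_swap_iff) (simp only: case_prod_beta' fst_conv snd_conv)
  interpret L: sigma_finite_measure ?L
    by (rule sigma_finite_measure_restrict_space) (auto intro: sigma_finite_lborel)
  have "(\<lambda>\<omega>. \<integral>\<^sup>+s. ennreal ((K s \<omega> - H s \<omega>)\<^sup>2) \<partial>?L) \<in> borel_measurable (F T)"
    by (rule L.borel_measurable_nn_integral[OF *])
  then show ?thesis
    using T_pos measurable_F_imp_M[of _ T borel] by (subst (asm) nn_integral_restrict_space) auto
qed

text \<open>On \<open>{a..<t}\<close> the process \<open>H\<close> is frozen at \<zeta>, so there
  \<open>K - H\<close> is itself simple, with values \<open>\<xi> k - \<zeta>\<close>, even if
  \<open>H\<close> is not simple elsewhere. The left-hand side concerns the integral of this
  difference over the interval, whose energy is at most the energy over \<open>{0..T}\<close>, so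
  the tail bound applies.\<close>

lemma simple_ito_increment_bound:
  assumes simple: "simple_ito_integral F T W K I" and H: "progressively_measurable F T H"
    and at: "0 \<le> a" "a < t" "t \<le> T"
    and \<zeta>: "\<zeta> \<in> borel_measurable (F a)" "\<And>s \<omega>. s \<in> {a..<t} \<Longrightarrow> H s \<omega> = \<zeta> \<omega>"
    and pos: "\<delta> > 0" "\<epsilon> > 0"
  shows "prob {\<omega>\<in>space M. \<bar>(I t \<omega> - I a \<omega>) - \<zeta> \<omega> * (W t \<omega> - W a \<omega>)\<bar> > \<epsilon>} \<le>
    prob {\<omega>\<in>space M. (\<integral>\<^sup>+s\<in>{0..T}. ennreal ((K s \<omega> - H s \<omega>)\<^sup>2) \<partial>lborel) > ennreal \<delta>} + \<delta> / \<epsilon>\<^sup>2"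
proof -
  obtain m :: nat and p \<xi> where p: "p 0 = 0" "p m = T" "\<forall>k<m. p k < p (Suc k)"
    and \<xi>: "\<forall>k<m. \<xi> k \<in> borel_measurable (F (p k))"
    and K: "K = (\<lambda>s \<omega>. \<Sum>k<m. \<xi> k \<omega> * indicator {p k<..p (Suc k)} s)"
    and I: "I = (\<lambda>t \<omega>. \<Sum>k<m. \<xi> k \<omega> * (W (min (p (Suc k)) t) \<omega> - W (min (p k) t) \<omega>))"
    using simple by (auto simp: simple_ito_integral_def)
  note p_mono = simple_ito_nodes(1)[OF p] and r = simple_ito_nodes(2)[OF p]
  txt \<open>Clamping the nodes to \<open>{a..t}\<close> avoids refining the partition; it may create empty intervals,
    on which \<open>\<xi> k\<close> need not be measurable at \<open>q k\<close> and the coefficient is set to 0.\<close>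
  define q where "q k = max a (min (p k) t)" for k
  define g where "g k \<omega> = (if q k < q (Suc k) then \<xi> k \<omega> - \<zeta> \<omega> else 0)" for k \<omega>
  have q0: "q 0 = a" and qm: "q m = t" using at p by (auto simp: q_def)
  have q_step: "q k \<le> q (Suc k)" if "k < m" for k
    using p(3) that by (fastforce simp: q_def)
  have q_range: "a \<le> q k" "q k \<le> t" for k using at by (auto simp: q_def)
  have q_strict: "p k \<le> q k" "q (Suc k) \<le> p (Suc k)" if "q k < q (Suc k)" for k
    using that at by (auto simp: q_def max_def min_def split: if_splits)
  have g_meas: "g k \<in> borel_measurable (F (q k))" if "k < m" for k
  proof (cases "q k < q (Suc k)")
    case True
    then have "\<xi> k \<in> borel_measurable (F (q k))" "\<zeta> \<in> borel_measurable (F (q k))"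
      using measurable_F_mono[of "\<xi> k" "p k" borel "q k"] measurable_F_mono[OF \<zeta>(1), of "q k"]
        \<xi> r[of k] q_range[of k] q_strict[of k] that at by auto
    then show ?thesis using True by (simp add: g_def[abs_def])
  qed (simp add: g_def[abs_def])
  have clamp: "W (min (p k) t) \<omega> - W (min (p k) a) \<omega> = W (q k) \<omega> - W a \<omega>" for k \<omega>
    using at by (auto simp: q_def max_def min_def)
  have "(I t \<omega> - I a \<omega>) - \<zeta> \<omega> * (W t \<omega> - W a \<omega>) = (\<Sum>k<m. g k \<omega> * (W (q (Suc k)) \<omega> - W (q k) \<omega>))" for \<omega>
  proof -
    \<comment> \<open>Truncating the nodes at \<open>t\<close> and at \<open>a\<close> and
      subtracting amounts to using the clamped nodes; the value \<open>W a\<close> cancels between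
      consecutive nodes.\<close>
    have "I t \<omega> - I a \<omega> = (\<Sum>k<m. \<xi> k \<omega> * (W (q (Suc k)) \<omega> - W (q k) \<omega>))"
      unfolding I sum_subtractf[symmetric]
    proof (intro sum.cong refl)
      fix k
      show "\<xi> k \<omega> * (W (min (p (Suc k)) t) \<omega> - W (min (p k) t) \<omega>) -
          \<xi> k \<omega> * (W (min (p (Suc k)) a) \<omega> - W (min (p k) a) \<omega>) =
          \<xi> k \<omega> * (W (q (Suc k)) \<omega> - W (q k) \<omega>)"
        using clamp[of k \<omega>] clamp[of "Suc k" \<omega>] unfolding right_diff_distrib[symmetric] by simp
    qed
    moreover have "\<zeta> \<omega> * (W t \<omega> - W a \<omega>) = (\<Sum>k<m. \<zeta> \<omega> * (W (q (Suc k)) \<omega> - W (q k) \<omega>))"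
      using sum_lessThan_telescope[of "\<lambda>k. W (q k) \<omega>" m] q0 qm by (simp add: sum_distrib_left[symmetric])
    ultimately have "(I t \<omega> - I a \<omega>) - \<zeta> \<omega> * (W t \<omega> - W a \<omega>) =
        (\<Sum>k<m. (\<xi> k \<omega> - \<zeta> \<omega>) * (W (q (Suc k)) \<omega> - W (q k) \<omega>))"
      by (simp add: sum_subtractf left_diff_distrib)
    \<comment> \<open>Where \<open>q k = q (Suc k)\<close> the increment of \<open>W\<close>
      vanishes, so resetting the coefficient to 0 does not affect the sum.\<close>
    also have "\<dots> = (\<Sum>k<m. g k \<omega> * (W (q (Suc k)) \<omega> - W (q k) \<omega>))"
      using q_step by (intro sum.cong) (force simp: g_def)+
    finally show ?thesis .
  qed
  then have "prob {\<omega>\<in>space M. \<bar>(I t \<omega> - I a \<omega>) - \<zeta> \<omega> * (W t \<omega> - W a \<omega>)\<bar> > \<epsilon>} \<le>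
      prob {\<omega>\<in>space M. (\<Sum>k<m. (g k \<omega>)\<^sup>2 * (q (Suc k) - q k)) > \<delta>} + \<delta> / \<epsilon>\<^sup>2"
    using simple_integral_tail_bound[of m q g \<delta> \<epsilon>] q_step q0 qm at g_meas pos by simp
  moreover have "prob {\<omega>\<in>space M. (\<Sum>k<m. (g k \<omega>)\<^sup>2 * (q (Suc k) - q k)) > \<delta>} \<le>
      prob {\<omega>\<in>space M. (\<integral>\<^sup>+s\<in>{0..T}. ennreal ((K s \<omega> - H s \<omega>)\<^sup>2) \<partial>lborel) > ennreal \<delta>}"
  proof (rule finite_measure_mono)
    have [measurable]:
      "(\<lambda>\<omega>. \<integral>\<^sup>+s\<in>{0..T}. ennreal ((K s \<omega> - H s \<omega>)\<^sup>2) \<partial>lborel) \<in> borel_measurable M"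
      by (rule energy_distance_measurable[OF simple H])
    show "{\<omega>\<in>space M. (\<integral>\<^sup>+s\<in>{0..T}. ennreal ((K s \<omega> - H s \<omega>)\<^sup>2) \<partial>lborel) > ennreal \<delta>} \<in> events"
      by measurable
    \<comment> \<open>Open intervals reconcile two endpoint conventions: \<open>K\<close> is
      constant on left-open cells \<open>{p k<..p (Suc k)}\<close>, while \<open>H\<close> equals
      \<zeta> on the right-open \<open>{a..<t}\<close>. Dropping endpoints costs no Lebesgue
      measure. The open intervals are disjoint, so at most one summand is nonzero at each
      \<open>s\<close>, and there it equals the integrand on the right.\<close>
    have "ennreal (\<Sum>k<m. (g k \<omega>)\<^sup>2 * (q (Suc k) - q k)) \<le>
        (\<integral>\<^sup>+s\<in>{0..T}. ennreal ((K s \<omega> - H s \<omega>)\<^sup>2) \<partial>lborel)" for \<omega>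
    proof -
      have "ennreal (\<Sum>k<m. (g k \<omega>)\<^sup>2 * (q (Suc k) - q k)) =
          (\<Sum>k<m. ennreal ((g k \<omega>)\<^sup>2) * emeasure lborel {q k<..<q (Suc k)})"
        using q_step by (subst sum_ennreal[symmetric]) (auto simp: ennreal_mult' intro!: sum.cong)
      also have "\<dots> = (\<integral>\<^sup>+s. (\<Sum>k<m. ennreal ((g k \<omega>)\<^sup>2) * indicator {q k<..<q (Suc k)} s) \<partial>lborel)"
        by (subst nn_integral_sum) (auto simp: nn_integral_cmult_indicator)
      also have "\<dots> \<le> (\<integral>\<^sup>+s\<in>{0..T}. ennreal ((K s \<omega> - H s \<omega>)\<^sup>2) \<partial>lborel)"
      proof (rule nn_integral_mono)
        fix s
        show "(\<Sum>k<m. ennreal ((g k \<omega>)\<^sup>2) * indicator {q k<..<q (Suc k)} s) \<le>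
          ennreal ((K s \<omega> - H s \<omega>)\<^sup>2) * indicator {0..T} s"
        proof (cases "\<exists>k<m. s \<in> {q k<..<q (Suc k)}")
          case True
          then obtain k where k: "k < m" "s \<in> {q k<..<q (Suc k)}" by auto
          then have qk: "q k < q (Suc k)" by simp
          have pk: "s \<in> {p k<..p (Suc k)}" using k q_strict[OF qk] by auto
          have uniq: "i = k" if "i < m" "s \<in> {p i<..p (Suc i)}" for i
          proof (rule ccontr)
            assume "i \<noteq> k"
            then consider "Suc i \<le> k" | "Suc k \<le> i" by linarith
            then show False
              using p_mono[of "Suc i" k] p_mono[of "Suc k" i] that pk k(1) by cases auto
          qed
          have uniq': "i = k" if "i < m" "s \<in> {q i<..<q (Suc i)}" for i
          proof -
            have "q i < q (Suc i)" using that by simp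
            then show ?thesis using uniq[OF that(1)] q_strict[of i] that by auto
          qed
          have "K s \<omega> = (\<Sum>i<m. if i = k then \<xi> i \<omega> else 0)"
            unfolding K
          proof (intro sum.cong refl)
            fix i assume "i \<in> {..<m}"
            then show "\<xi> i \<omega> * indicator {p i<..p (Suc i)} s = (if i = k then \<xi> i \<omega> else 0)"
              using uniq[of i] pk by (cases "i = k") (auto simp: indicator_def)
          qed
          then have "K s \<omega> = \<xi> k \<omega>" using k by simp
          moreover have "H s \<omega> = \<zeta> \<omega>"
            using \<zeta>(2)[of s] k q_range[of k] q_range[of "Suc k"] by auto
          moreover have "(\<Sum>i<m. ennreal ((g i \<omega>)\<^sup>2) * indicator {q i<..<q (Suc i)} s) =
              (\<Sum>i<m. if i = k then ennreal ((g i \<omega>)\<^sup>2) else 0)"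
          proof (intro sum.cong refl)
            fix i assume "i \<in> {..<m}"
            then have "s \<in> {q i<..<q (Suc i)} \<longleftrightarrow> i = k"
              using uniq'[of i] k(2) by blast
            then show "ennreal ((g i \<omega>)\<^sup>2) * indicator {q i<..<q (Suc i)} s =
                (if i = k then ennreal ((g i \<omega>)\<^sup>2) else 0)"
              by (simp only: indicator_def if_True if_False mult_1_right mult_zero_right split: if_split)
                simp
          qed
          moreover have "s \<in> {0..T}"
            using k q_range[of k] q_range[of "Suc k"] at by auto
          ultimately show ?thesis using k qk by (simp add: g_def)
        next
          case False
          then have "(\<Sum>k<m. ennreal ((g k \<omega>)\<^sup>2) * indicator {q k<..<q (Suc k)} s) = 0"
            by (intro sum.neutral) (auto simp: indicator_def)
          then show ?thesis by simp
        qed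
      qed
      finally show ?thesis .
    qed
    note energy_le = this
    show "{\<omega>\<in>space M. (\<Sum>k<m. (g k \<omega>)\<^sup>2 * (q (Suc k) - q k)) > \<delta>} \<subseteq>
      {\<omega>\<in>space M. (\<integral>\<^sup>+s\<in>{0..T}. ennreal ((K s \<omega> - H s \<omega>)\<^sup>2) \<partial>lborel) > ennreal \<delta>}"
    proof (intro Collect_mono impI, elim conjE, intro conjI)
      fix \<omega> assume "\<delta> < (\<Sum>k<m. (g k \<omega>)\<^sup>2 * (q (Suc k) - q k))"
      then have "ennreal \<delta> < ennreal (\<Sum>k<m. (g k \<omega>)\<^sup>2 * (q (Suc k) - q k))"
        using pos by (intro ennreal_lessI) auto
      then show "(\<integral>\<^sup>+s\<in>{0..T}. ennreal ((K s \<omega> - H s \<omega>)\<^sup>2) \<partial>lborel) > ennreal \<delta>"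
        using energy_le[of \<omega>] by (rule less_le_trans)
    qed
  qed
  ultimately show ?thesis by linarith
qed

section \<open>Passage to the limit: increments of the Ito integral over frozen intervals\<close>

lemma AE_eq_0_if_prob_tail_0:
  fixes D :: "'a \<Rightarrow> real"
  assumes [measurable]: "D \<in> borel_measurable M"
    and D: "\<And>\<epsilon>. \<epsilon> > 0 \<Longrightarrow> prob {\<omega>\<in>space M. \<bar>D \<omega>\<bar> > \<epsilon>} = 0"
  shows "AE \<omega> in M. D \<omega> = 0"
proof -
  have "AE \<omega> in M. \<forall>n. \<bar>D \<omega>\<bar> \<le> 1 / real (Suc n)"
  proof (subst AE_all_countable, rule allI)
    fix n
    have "prob {\<omega>\<in>space M. \<bar>D \<omega>\<bar> > 1 / real (Suc n)} = 0" by (rule D) simp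
    then have "{\<omega>\<in>space M. \<bar>D \<omega>\<bar> > 1 / real (Suc n)} \<in> null_sets M"
      by (auto simp: null_sets_def emeasure_eq_measure)
    then show "AE \<omega> in M. \<bar>D \<omega>\<bar> \<le> 1 / real (Suc n)"
      by (rule AE_I') auto
  qed
  then show ?thesis
  proof (rule AE_mp, intro AE_I2 impI)
    fix \<omega> assume *: "\<forall>n. \<bar>D \<omega>\<bar> \<le> 1 / real (Suc n)"
    show "D \<omega> = 0"
    proof (rule ccontr)
      assume "D \<omega> \<noteq> 0"
      then obtain n where "1 / real (Suc n) < \<bar>D \<omega>\<bar>"
        using nat_approx_posE[of "\<bar>D \<omega>\<bar>"] by auto
      then show False using * by (meson not_le)
    qed
  qed
qed

text \<open>The approximants vanish at time 0, so the tail probability in the convergence condition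
  does not depend on \<open>j\<close>; since it tends to 0, it is 0.\<close>

lemma ito_integral_at_0:
  assumes "ito_integral M F T W H I"
  shows "AE \<omega> in M. I 0 \<omega> = 0"
proof -
  obtain Hs Is where simple: "\<And>j::nat. simple_ito_integral F T W (Hs j) (Is j)"
    and conv: "\<And>t \<epsilon>. t \<in> {0..T} \<Longrightarrow> \<epsilon> > 0 \<Longrightarrow>
      (\<lambda>j. measure M {\<omega> \<in> space M. \<bar>Is j t \<omega> - I t \<omega>\<bar> > \<epsilon>}) \<longlonglongrightarrow> 0"
    and adapted: "adapted_process F T I"
    using assms unfolding ito_integral_def by blast
  show ?thesis
  proof (rule AE_eq_0_if_prob_tail_0)
    show "I 0 \<in> borel_measurable M"
      using adapted T_pos measurable_F_imp_M[of "I 0" 0] by (auto simp: adapted_process_def)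
    fix \<epsilon> :: real assume "\<epsilon> > 0"
    then show "prob {\<omega> \<in> space M. \<bar>I 0 \<omega>\<bar> > \<epsilon>} = 0"
      using conv[of 0 \<epsilon>] T_pos by (simp add: simple_ito_at_0[OF simple] tendsto_const_iff)
  qed
qed

text \<open>The error is split through the approximants into their errors at \<open>t\<close> and at
  \<open>a\<close> and the error of the simple increment. Letting \<open>j\<close> tend to infinity
  with \<delta> fixed removes everything except the Chebyshev term, and then \<delta> tends to
  0.\<close>

lemma ito_integral_increment:
  assumes ito: "ito_integral M F T W H I"
    and at: "0 \<le> a" "a < t" "t \<le> T"
    and \<zeta>: "\<zeta> \<in> borel_measurable (F a)" "\<And>s \<omega>. s \<in> {a..<t} \<Longrightarrow> H s \<omega> = \<zeta> \<omega>"
  shows "AE \<omega> in M. I t \<omega> - I a \<omega> = \<zeta> \<omega> * (W t \<omega> - W a \<omega>)"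
proof -
  obtain Hs Is where simple: "\<And>j::nat. simple_ito_integral F T W (Hs j) (Is j)"
    and energy: "\<And>\<delta>. \<delta> > 0 \<Longrightarrow> (\<lambda>j. measure M {\<omega> \<in> space M.
      (\<integral>\<^sup>+s\<in>{0..T}. ennreal ((Hs j s \<omega> - H s \<omega>)\<^sup>2) \<partial>lborel) > ennreal \<delta>}) \<longlonglongrightarrow> 0"
    and conv: "\<And>t \<epsilon>. t \<in> {0..T} \<Longrightarrow> \<epsilon> > 0 \<Longrightarrow>
      (\<lambda>j. measure M {\<omega> \<in> space M. \<bar>Is j t \<omega> - I t \<omega>\<bar> > \<epsilon>}) \<longlonglongrightarrow> 0"
    and adapted: "adapted_process F T I" and H: "progressively_measurable F T H"
    using ito unfolding ito_integral_def by blast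
  have I_meas: "I s \<in> borel_measurable M" if "s \<in> {0..T}" for s
    using adapted that measurable_F_imp_M[of "I s" s] by (auto simp: adapted_process_def)
  have W_meas: "W s \<in> borel_measurable M" if "s \<in> {0..T}" for s
    using measurable_F_imp_M[OF W_measurable_F] that by auto
  have T: "t \<in> {0..T}" "a \<in> {0..T}" using at by auto
  note [measurable] = I_meas[OF T(1)] I_meas[OF T(2)] W_meas[OF T(1)] W_meas[OF T(2)]
    measurable_F_imp_M[OF \<zeta>(1) T(2)] simple_ito_measurable[OF simple T(1)]
    simple_ito_measurable[OF simple T(2)]
  let ?D = "\<lambda>\<omega>. I t \<omega> - I a \<omega> - \<zeta> \<omega> * (W t \<omega> - W a \<omega>)"
  have "AE \<omega> in M. ?D \<omega> = 0"
  proof (rule AE_eq_0_if_prob_tail_0)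
    show "?D \<in> borel_measurable M" by measurable
    fix \<epsilon> :: real assume "\<epsilon> > 0"
    \<comment> \<open>One third of the tolerance for each of the three errors.\<close>
    define e where "e = \<epsilon> / 3"
    have e: "e > 0" "\<epsilon> = e + e + e" using \<open>\<epsilon> > 0\<close> by (auto simp: e_def)
    let ?P = "prob {\<omega>\<in>space M. \<bar>?D \<omega>\<bar> > \<epsilon>}"
    have bound: "?P \<le> \<delta> / e\<^sup>2" if \<delta>: "\<delta> > 0" for \<delta>
    proof -
      let ?A = "\<lambda>j. {\<omega> \<in> space M. \<bar>Is j t \<omega> - I t \<omega>\<bar> > e}"
      let ?B = "\<lambda>j. {\<omega> \<in> space M. \<bar>Is j a \<omega> - I a \<omega>\<bar> > e}"
      let ?C = "\<lambda>j. {\<omega> \<in> space M. \<bar>(Is j t \<omega> - Is j a \<omega>) - \<zeta> \<omega> * (W t \<omega> - W a \<omega>)\<bar> > e}"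
      let ?E = "\<lambda>j. measure M {\<omega> \<in> space M.
        (\<integral>\<^sup>+s\<in>{0..T}. ennreal ((Hs j s \<omega> - H s \<omega>)\<^sup>2) \<partial>lborel) > ennreal \<delta>}"
      have "?P \<le> prob (?A j) + prob (?B j) + (?E j + \<delta> / e\<^sup>2)" for j
      proof -
        have "?P \<le> prob (?A j \<union> ?B j \<union> ?C j)"
        proof (rule finite_measure_mono)
          show "{\<omega>\<in>space M. \<bar>?D \<omega>\<bar> > \<epsilon>} \<subseteq> ?A j \<union> ?B j \<union> ?C j"
            unfolding e(2) by (rule subsetI) (simp, linarith)
        qed measurable
        also have "\<dots> \<le> prob (?A j \<union> ?B j) + prob (?C j)"
          by (rule measure_Un_le) measurable
        also have "\<dots> \<le> prob (?A j) + prob (?B j) + prob (?C j)"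
          by (intro add_right_mono measure_Un_le) measurable
        also have "prob (?C j) \<le> ?E j + \<delta> / e\<^sup>2"
          by (rule simple_ito_increment_bound[OF simple H at \<zeta> \<delta> e(1)])
        finally show ?thesis by simp
      qed
      moreover have "(\<lambda>j. prob (?A j) + prob (?B j) + (?E j + \<delta> / e\<^sup>2)) \<longlonglongrightarrow> 0 + 0 + (0 + \<delta> / e\<^sup>2)"
        by (intro tendsto_add conv energy T e \<delta> tendsto_const)
      ultimately have "?P \<le> 0 + 0 + (0 + \<delta> / e\<^sup>2)"
        by (intro LIMSEQ_le_const) auto
      then show ?thesis by simp
    qed
    \<comment> \<open>Choosing \<delta> as \<open>d * e\<^sup>2\<close> turns the remaining bound
      into the arbitrary positive \<open>d\<close>.\<close>
    have "?P \<le> 0"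
    proof (rule field_le_epsilon)
      fix d :: real assume "d > 0"
      then show "?P \<le> 0 + d" using bound[of "d * e\<^sup>2"] e by simp
    qed
    then show "?P = 0" using measure_nonneg[of M] by (metis antisym)
  qed
  then show ?thesis by simp
qed

section \<open>Avoidance of the zero set, for one increment and then along the grid\<close>

text \<open>By independence the joint law of \<open>Y\<close> and the increment is a product, so
  \<open>y\<close> can be fixed. If \<open>\<sigma> y\<close> is nonzero, the affine map in
  \<open>w\<close> is injective, hence only countably many \<open>w\<close> hit \<open>Z\<close>,
  and these form a null set for the Gaussian density.\<close>

lemma affine_increment_avoids_countable:
  assumes at: "0 \<le> a" "a < t" "t \<le> T"
    and Y: "Y \<in> borel_measurable (F a)" and \<sigma>[measurable]: "\<sigma> \<in> borel_measurable borel"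
    and Z: "countable Z" and nz: "AE \<omega> in M. \<sigma> (Y \<omega>) \<noteq> 0"
  shows "AE \<omega> in M. Y \<omega> + \<sigma> (Y \<omega>) * (W t \<omega> - W a \<omega>) \<notin> Z"
proof -
  let ?D = "\<lambda>\<omega>. W t \<omega> - W a \<omega>"
  have ZB[measurable]: "Z \<in> sets borel" by (rule sets.countable[OF _ Z]) auto
  have [measurable]: "Y \<in> borel_measurable M" using measurable_F_imp_M[OF Y] at by auto
  have [measurable]: "?D \<in> borel_measurable M"
    using measurable_F_imp_M[OF increment_measurable, of a t] at by auto
  have joint: "distr M borel Y \<Otimes>\<^sub>M distr M borel ?D = distr M (borel \<Otimes>\<^sub>M borel) (\<lambda>\<omega>. (Y \<omega>, ?D \<omega>))"
    using increment_indep[OF at Y] unfolding indep_var_distribution_eq by simp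
  interpret Yd: prob_space "distr M borel Y" by (rule prob_space_distr) simp
  interpret Dd: prob_space "distr M borel ?D" by (rule prob_space_distr) simp
  interpret P: pair_sigma_finite "distr M borel Y" "distr M borel ?D" ..
  have dens: "distr M borel ?D = density lborel (normal_density 0 (sqrt (t - a)))"
    using distributed_distr_eq_density[OF increment_distributed[OF at]]
    by (metis distr_cong sets_lborel)
  \<comment> \<open>The condition \<open>\<sigma> y \<noteq> 0\<close> is kept inside the event, so
    the claim holds for every \<open>y\<close>; \<open>nz\<close> removes it at the end, after the
    statement has been carried back to \<open>M\<close>.\<close>
  have "AE y in distr M borel Y. AE w in distr M borel ?D. \<sigma> y \<noteq> 0 \<longrightarrow> y + \<sigma> y * w \<notin> Z"
  proof (rule AE_I2)
    fix y
    show "AE w in distr M borel ?D. \<sigma> y \<noteq> 0 \<longrightarrow> y + \<sigma> y * w \<notin> Z"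
    proof (cases "\<sigma> y = 0")
      case False
      have "{w. y + \<sigma> y * w \<in> Z} \<subseteq> (\<lambda>z. (z - y) / \<sigma> y) ` Z"
        using False by (auto simp: image_iff field_simps intro!: bexI)
      then have "countable {w. y + \<sigma> y * w \<in> Z}"
        using Z by (meson countable_image countable_subset)
      then have "{w. y + \<sigma> y * w \<in> Z} \<in> null_sets lborel"
        by (rule countable_imp_null_set_lborel)
      then have "AE w in lborel. y + \<sigma> y * w \<notin> Z"
        by (rule AE_I') auto
      then show ?thesis
        unfolding dens by (subst AE_density) auto
    qed simp
  qed
  moreover have [measurable]: "(\<lambda>x. \<sigma> (fst x)) \<in> borel_measurable (borel \<Otimes>\<^sub>M borel)"
    by (rule measurable_compose[OF measurable_fst \<sigma>])
  have avoid[measurable]: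
    "Measurable.pred (borel \<Otimes>\<^sub>M borel) (\<lambda>x. \<sigma> (fst x) \<noteq> 0 \<longrightarrow> fst x + \<sigma> (fst x) * snd x \<notin> Z)"
    by measurable
  ultimately have "AE x in distr M borel Y \<Otimes>\<^sub>M distr M borel ?D. \<sigma> (fst x) \<noteq> 0 \<longrightarrow> fst x + \<sigma> (fst x) * snd x \<notin> Z"
    using avoid by (intro P.AE_pair_measure) (simp_all only: pred_def space_pair_measure space_distr
      sets_pair_measure_cong[OF sets_distr sets_distr] fst_conv snd_conv)
  then have "AE \<omega> in M. \<sigma> (Y \<omega>) \<noteq> 0 \<longrightarrow> Y \<omega> + \<sigma> (Y \<omega>) * ?D \<omega> \<notin> Z"
    unfolding joint by (subst (asm) AE_distr_iff) (use avoid in \<open>simp_all add: pred_def\<close>)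
  with nz show ?thesis by eventually_elim auto
qed

text \<open>Avoidance at a node propagates to every later time of the following grid cell, including
  the next node. Induction therefore covers all nodes, and one further application covers any time
  between them.\<close>

lemma euler_maruyama_avoids_zero_set:
  assumes em: "euler_maruyama M F T W \<sigma> n x X" and n: "n \<ge> 1"
    and \<sigma>: "\<sigma> \<in> borel_measurable borel" and Z: "countable (zero_set \<sigma>)" and x: "x \<notin> zero_set \<sigma>"
    and t: "t \<in> {0..T}"
  shows "AE \<omega> in M. X t \<omega> \<notin> zero_set \<sigma>"
proof -
  have ito: "ito_integral M F T W (\<lambda>s \<omega>. \<sigma> (X (eta T n s) \<omega>)) (\<lambda>t \<omega>. X t \<omega> - x)"
    using em by (simp add: euler_maruyama_def)
  have X_meas: "X s \<in> borel_measurable (F s)" if "s \<in> {0..T}" for s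
  proof -
    have "(\<lambda>\<omega>. X s \<omega> - x + x) \<in> borel_measurable (F s)"
      using ito that by (intro borel_measurable_add) (auto simp: ito_integral_def adapted_process_def)
    then show ?thesis by simp
  qed
  have zero: "AE \<omega> in M. X 0 \<omega> \<notin> zero_set \<sigma>"
    using ito_integral_at_0[OF ito] by eventually_elim (use x in auto)
  have grid_range: "grid T n k \<in> {0..T}" if "k \<le> n" for k
    using that T_pos n by (auto simp: grid_def field_simps)
  have step: "AE \<omega> in M. X t \<omega> \<notin> zero_set \<sigma>"
    if k: "k < n" and t: "grid T n k < t" "t \<le> grid T n (Suc k)"
      and IH: "AE \<omega> in M. X (grid T n k) \<omega> \<notin> zero_set \<sigma>" for k t
  proof -
    let ?a = "grid T n k"
    have at: "0 \<le> ?a" "?a < t" "t \<le> T"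
      using grid_range[of k] grid_range[of "Suc k"] k t by auto
    have Xa: "X ?a \<in> borel_measurable (F ?a)" using X_meas at by auto
    have "(\<lambda>\<omega>. \<sigma> (X ?a \<omega>)) \<in> borel_measurable (F ?a)"
      using measurable_compose[OF Xa \<sigma>] .
    moreover have "\<sigma> (X (eta T n s) \<omega>) = \<sigma> (X ?a \<omega>)" if "s \<in> {?a..<t}" for s \<omega>
      using eta_eq_grid[OF T_pos n, of s k] that t by auto
    ultimately have "AE \<omega> in M. (X t \<omega> - x) - (X ?a \<omega> - x) = \<sigma> (X ?a \<omega>) * (W t \<omega> - W ?a \<omega>)"
      by (rule ito_integral_increment[OF ito at])
    moreover have "AE \<omega> in M. \<sigma> (X ?a \<omega>) \<noteq> 0"
      using IH by (simp add: zero_set_def)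
    then have "AE \<omega> in M. X ?a \<omega> + \<sigma> (X ?a \<omega>) * (W t \<omega> - W ?a \<omega>) \<notin> zero_set \<sigma>"
      by (rule affine_increment_avoids_countable[OF at Xa \<sigma> Z])
    ultimately show ?thesis
    proof eventually_elim
      case (elim \<omega>)
      then have "X t \<omega> = X ?a \<omega> + \<sigma> (X ?a \<omega>) * (W t \<omega> - W ?a \<omega>)" by linarith
      then show ?case using elim by metis
    qed
  qed
  have nodes: "AE \<omega> in M. X (grid T n k) \<omega> \<notin> zero_set \<sigma>" if "k \<le> n" for k
    using that
  proof (induction k)
    case 0 then show ?case using zero by (simp add: grid_def)
  next
    case (Suc k)
    show ?case
      by (rule step[of k]) (use Suc T_pos n in \<open>auto simp: grid_def field_simps\<close>)
  qed
  show ?thesis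
  proof (cases "t = 0")
    case False
    \<comment> \<open>Ceiling minus one selects the left-open, right-closed cell containing
      \<open>t\<close>: then \<open>t\<close> lies strictly after node \<open>k\<close>, so the
      Gaussian increment is nondegenerate, and \<open>t = T\<close> falls into the last cell
      \<open>k = n - 1\<close>.\<close>
    define k where "k = nat (\<lceil>t * real n / T\<rceil> - 1)"
    have pos: "0 < t * real n / T" using False t T_pos n by auto
    have le: "t * real n / T \<le> real n" using t T_pos by (auto simp: field_simps intro: mult_right_mono)
    have k: "real k < t * real n / T" "t * real n / T \<le> real k + 1"
      using pos unfolding k_def by linarith+
    have "k < n" using k(1) le by linarith
    moreover have "grid T n k < t" "t \<le> grid T n (Suc k)"
      using k T_pos n by (auto simp: grid_def field_simps)
    ultimately show ?thesis using step[of k t] nodes[of k] by auto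
  qed (use zero in simp)
qed

end

section \<open>Joint measurability and occupation time\<close>

text \<open>\<open>X\<close> is the pointwise limit of processes that sample it at the last multiple
  of \<open>1 / Suc j\<close>. Each of these depends on time only through an integer index, so it is
  jointly measurable, and continuity of the paths gives the convergence.\<close>

lemma continuous_paths_jointly_measurable:
  fixes X :: "real \<Rightarrow> 'a \<Rightarrow> real"
  assumes "0 \<le> T" and X: "\<And>t. t \<in> {0..T} \<Longrightarrow> X t \<in> borel_measurable M"
    and cont: "\<And>\<omega>. \<omega> \<in> space M \<Longrightarrow> continuous_on {0..T} (\<lambda>t. X t \<omega>)"
  shows "(\<lambda>(s, \<omega>). X s \<omega>) \<in> borel_measurable (restrict_space borel {0..T} \<Otimes>\<^sub>M M)"
proof (rule borel_measurable_LIMSEQ_real)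
  let ?R = "restrict_space borel {0..T} \<Otimes>\<^sub>M M"
  \<comment> \<open>Clamping to \<open>{0..T}\<close> makes \<open>X (c j i)\<close> measurable for
    every integer \<open>i\<close>, also for indices that no time in the interval produces.\<close>
  define c where "c j i = max 0 (min T (of_int i / real (Suc j)))" for j and i :: int
  define f where "f j x = X (c j \<lfloor>fst x * real (Suc j)\<rfloor>) (snd x)" for j x
  have [measurable]: "fst \<in> borel_measurable ?R"
    by (rule measurable_compose[OF measurable_fst measurable_restrict_space1]) simp
  show "f j \<in> borel_measurable ?R" for j
    unfolding f_def
  proof (rule measurable_compose_countable)
    show "(\<lambda>x. X (c j i) (snd x)) \<in> borel_measurable ?R" for i
      using X[of "c j i"] assms(1) by (intro measurable_compose[OF measurable_snd]) (auto simp: c_def)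
  qed measurable
  fix x assume "x \<in> space ?R"
  then obtain s \<omega> where x: "x = (s, \<omega>)" "s \<in> {0..T}" "\<omega> \<in> space M"
    by (auto simp: space_pair_measure space_restrict_space)
  have lim: "(\<lambda>j. of_int \<lfloor>s * real (Suc j)\<rfloor> / real (Suc j)) \<longlonglongrightarrow> s"
  proof (rule tendsto_sandwich)
    show "\<forall>\<^sub>F j in sequentially. s - 1 / real (Suc j) \<le> of_int \<lfloor>s * real (Suc j)\<rfloor> / real (Suc j)"
    proof (intro always_eventually allI)
      fix j
      have "s * real (Suc j) - 1 \<le> of_int \<lfloor>s * real (Suc j)\<rfloor>" by linarith
      then have "(s * real (Suc j) - 1) / real (Suc j) \<le> of_int \<lfloor>s * real (Suc j)\<rfloor> / real (Suc j)"
        by (intro divide_right_mono) auto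
      then show "s - 1 / real (Suc j) \<le> of_int \<lfloor>s * real (Suc j)\<rfloor> / real (Suc j)"
        by (simp add: diff_divide_distrib)
    qed
    show "\<forall>\<^sub>F j in sequentially. of_int \<lfloor>s * real (Suc j)\<rfloor> / real (Suc j) \<le> s"
    proof (intro always_eventually allI)
      fix j
      show "of_int \<lfloor>s * real (Suc j)\<rfloor> / real (Suc j) \<le> s"
        by (subst pos_divide_le_eq) (simp, rule of_int_floor_le)
    qed
    show "(\<lambda>j. s - 1 / real (Suc j)) \<longlonglongrightarrow> s"
      using tendsto_diff[OF tendsto_const LIMSEQ_inverse_real_of_nat, of s] by (simp add: inverse_eq_divide)
  qed simp
  have "(\<lambda>j. c j \<lfloor>s * real (Suc j)\<rfloor>) \<longlonglongrightarrow> max 0 (min T s)"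
    unfolding c_def by (intro tendsto_max tendsto_min tendsto_const lim)
  then have "(\<lambda>j. c j \<lfloor>s * real (Suc j)\<rfloor>) \<longlonglongrightarrow> s" using x by simp
  then have "(\<lambda>j. X (c j \<lfloor>s * real (Suc j)\<rfloor>) \<omega>) \<longlonglongrightarrow> X s \<omega>"
    by (rule continuous_on_tendsto_compose[OF cont[OF x(3)]]) (use x assms(1) in \<open>auto simp: c_def\<close>)
  then show "(\<lambda>j. f j x) \<longlonglongrightarrow> (case x of (s, \<omega>) \<Rightarrow> X s \<omega>)"
    by (simp add: f_def x)
qed

text \<open>Tonelli's theorem turns the expected occupation time into the time integral of the
  measures of the events \<open>X s \<omega> \<in> Z\<close>, each of which is 0.\<close>

lemma occupation_time_eq_0:
  fixes X :: "real \<Rightarrow> 'a \<Rightarrow> real"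
  assumes "sigma_finite_measure M" "0 \<le> T" and X: "\<And>t. t \<in> {0..T} \<Longrightarrow> X t \<in> borel_measurable M"
    and cont: "continuous_paths M T X" and Z[measurable]: "Z \<in> sets borel"
    and avoid: "\<And>t. t \<in> {0..T} \<Longrightarrow> AE \<omega> in M. X t \<omega> \<notin> Z"
  shows "(\<integral>\<^sup>+\<omega>. (\<integral>\<^sup>+s\<in>{0..T}. indicator Z (X s \<omega>) \<partial>lborel) \<partial>M) = 0"
proof -
  let ?L = "restrict_space lborel {0..T} :: real measure"
  obtain N where N: "N \<in> null_sets M" "{\<omega>\<in>space M. \<not> continuous_on {0..T} (\<lambda>t. X t \<omega>)} \<subseteq> N"
    using cont unfolding continuous_paths_def eventually_ae_filter by auto
  txt \<open>Paths of \<open>X\<close> may be irregular on \<open>N\<close>, so \<open>X\<close> itself need not be jointly measurable.\<close>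
  define Y where "Y t \<omega> = (if \<omega> \<in> N then 0 else X t \<omega>)" for t \<omega>
  have [measurable]: "N \<in> sets M" using N by auto
  have Y_meas: "Y t \<in> borel_measurable M" if "t \<in> {0..T}" for t
    using X[OF that] unfolding Y_def by measurable
  \<comment> \<open>A single null set serves all times at once, so the inner time integrals for
    \<open>X\<close> and \<open>Y\<close> agree almost everywhere.\<close>
  have Y_eq: "AE \<omega> in M. \<forall>t. Y t \<omega> = X t \<omega>"
    using AE_not_in[OF N(1)] by eventually_elim (simp add: Y_def)
  have Y_joint: "(\<lambda>(s, \<omega>). Y s \<omega>) \<in> borel_measurable (restrict_space borel {0..T} \<Otimes>\<^sub>M M)"
  proof (rule continuous_paths_jointly_measurable[OF assms(2) Y_meas])
    fix \<omega> assume "\<omega> \<in> space M"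
    then show "continuous_on {0..T} (\<lambda>t. Y t \<omega>)"
      using N(2) by (cases "\<omega> \<in> N") (auto simp: Y_def)
  qed
  then have [measurable]: "(\<lambda>x. Y (fst x) (snd x)) \<in> borel_measurable (?L \<Otimes>\<^sub>M M)"
    by (subst measurable_cong_sets[OF sets_pair_measure_cong refl, of _ "restrict_space borel {0..T}"])
      (auto simp: case_prod_beta' intro!: sets_restrict_space_cong)
  interpret M: sigma_finite_measure M by fact
  interpret L: sigma_finite_measure ?L
    by (rule sigma_finite_measure_restrict_space) (auto intro: sigma_finite_lborel)
  interpret P: pair_sigma_finite ?L M ..
  have "(\<integral>\<^sup>+\<omega>. (\<integral>\<^sup>+s\<in>{0..T}. indicator Z (X s \<omega>) \<partial>lborel) \<partial>M) =
      (\<integral>\<^sup>+\<omega>. (\<integral>\<^sup>+s\<in>{0..T}. indicator Z (Y s \<omega>) \<partial>lborel) \<partial>M)"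
    by (intro nn_integral_cong_AE AE_mp[OF Y_eq AE_I2]) auto
  also have "\<dots> = (\<integral>\<^sup>+\<omega>. (\<integral>\<^sup>+s. indicator Z (Y s \<omega>) \<partial>?L) \<partial>M)"
    by (subst nn_integral_restrict_space) auto
  also have "\<dots> = (\<integral>\<^sup>+s. (\<integral>\<^sup>+\<omega>. indicator Z (Y s \<omega>) \<partial>M) \<partial>?L)"
    by (rule P.Fubini') (simp add: case_prod_beta')
  also have "\<dots> = (\<integral>\<^sup>+s. 0 \<partial>?L)"
  proof (rule nn_integral_cong)
    fix s assume "s \<in> space ?L"
    then have s: "s \<in> {0..T}" by (simp add: space_restrict_space)
    have "(\<integral>\<^sup>+\<omega>. indicator Z (Y s \<omega>) \<partial>M) = (\<integral>\<^sup>+\<omega>. 0 \<partial>M)"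
    proof (rule nn_integral_cong_AE)
      show "AE \<omega> in M. indicator Z (Y s \<omega>) = (0 :: ennreal)"
        using Y_eq avoid[OF s] by eventually_elim simp
    qed
    then show "(\<integral>\<^sup>+\<omega>. indicator Z (Y s \<omega>) \<partial>M) = 0" by simp
  qed
  finally show ?thesis by simp
qed

theorem lemma2p3:
  fixes M :: "'a measure" and F :: "real \<Rightarrow> 'a measure"
    and W :: "real \<Rightarrow> 'a \<Rightarrow> real"
    and T x0 :: real and \<sigma> :: "real \<Rightarrow> real"
    and x :: "nat \<Rightarrow> real" and X :: "nat \<Rightarrow> real \<Rightarrow> 'a \<Rightarrow> real"
  assumes "prob_space M"
    and "T > 0"
    and "usual_filtration M F T"
    and "brownian_motion M F T W"
    and "\<sigma> \<in> borel_measurable borel"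
    and "zero_set \<sigma> \<noteq> {}" and "countable (zero_set \<sigma>)"
    and "\<forall>n\<ge>1. x n \<notin> zero_set \<sigma>" and "x \<longlonglongrightarrow> x0"
    and "\<forall>n\<ge>1. euler_maruyama M F T W \<sigma> n (x n) (X n)"
  shows "\<forall>n\<ge>1. non_sticky M T \<sigma> (X n)"
proof (intro allI impI)
  fix n :: nat assume n: "n \<ge> 1"
  interpret prob_space M by fact
  interpret brownian_setting M F W T
    by unfold_locales (use assms in auto)
  have em: "euler_maruyama M F T W \<sigma> n (x n) (X n)" and xn: "x n \<notin> zero_set \<sigma>"
    using assms n by auto
  have ito: "ito_integral M F T W (\<lambda>s \<omega>. \<sigma> (X n (eta T n s) \<omega>)) (\<lambda>t \<omega>. X n t \<omega> - x n)"
    using em by (simp add: euler_maruyama_def)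
  show "non_sticky M T \<sigma> (X n)"
    unfolding non_sticky_def
  \<comment> \<open>It suffices to avoid the zero set almost surely at each fixed time; the
    exceptional null set may vary with \<open>t\<close>, because after the exchange of integrals
    only its measure counts.\<close>
  proof (rule occupation_time_eq_0)
    show "sigma_finite_measure M" by unfold_locales
    show "0 \<le> T" using T_pos by simp
    show "X n t \<in> borel_measurable M" if "t \<in> {0..T}" for t
    proof -
      have "(\<lambda>\<omega>. X n t \<omega> - x n) \<in> borel_measurable M"
        using ito that by (intro measurable_F_imp_M[of _ t]) (auto simp: ito_integral_def adapted_process_def)
      then have "(\<lambda>\<omega>. X n t \<omega> - x n + x n) \<in> borel_measurable M"
        by (intro borel_measurable_add) auto
      then show ?thesis by simp
    qed
    have "AE \<omega> in M. continuous_on {0..T} (\<lambda>t. X n t \<omega> - x n)"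
      using ito by (simp add: ito_integral_def continuous_paths_def)
    then show "continuous_paths M T (X n)"
      unfolding continuous_paths_def
    proof eventually_elim
      case (elim \<omega>)
      then have "continuous_on {0..T} (\<lambda>t. X n t \<omega> - x n + x n)"
        by (intro continuous_on_add) auto
      then show ?case by simp
    qed
    show "zero_set \<sigma> \<in> sets borel"
      by (rule sets.countable[OF _ assms(7)]) auto
    show "AE \<omega> in M. X n t \<omega> \<notin> zero_set \<sigma>" if "t \<in> {0..T}" for t
      by (rule euler_maruyama_avoids_zero_set[OF em n assms(5) assms(7) xn that])
  qed
qed

end
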